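(* Let $X$ be a heap with operation $[-]$, and regard $X$ as a ternary self-distributive set with $T(x,y,z)=[x,y,z]$. Let $A$ be an abelian group. Suppose $\eta\in Z^2_{\rm H}(X,A)$, that is, $\eta:X^3\to A$ satisfies $\delta^2_{(1)}\eta=0=\delta^2_{(2)}\eta$ and the degeneracy condition. Then $\eta$ is a TSD $2$-cocycle, $\eta\in Z^2_{\rm SD}(X,A)$. This assignment induces an injection of $H^2_{\rm H}(X,A)$ into $H^2_{\rm SD}(X,A)$.
   Context: A heap is a non-empty set $X$ with a ternary operation satisfying $[[x_1,x_2,x_3],x_4,x_5]=[x_1,[x_4,x_3,x_2],x_5]=[x_1,x_2,[x_3,x_4,x_5]]$, $[x,x,y]=y$ and $[x,y,y]=x$. A ternary operation $T$ is ternary self-distributive (TSD) if $T(T(x,y,z),u,v)=T(T(x,u,v),T(y,u,v),T(z,u,v))$ for all arguments; every heap operation is TSD. Heap cohomology: for $f:X\to A$, $\delta^1_{\rm PA}f(x,y,z)=f([x,y,z])-f(x)+f(y)-f(z)$; for $\eta:X^3\to A$, $\delta^2_{(1)}\eta(x_1,\dots,x_5)=\eta(x_1,x_2,x_3)+\eta([x_1,x_2,x_3],x_4,x_5)+\eta(x_4,x_3,x_2)-\eta(x_1,[x_4,x_3,x_2],x_5)$, $\delta^2_{(2)}\eta(x_1,\dots,x_5)=\eta(x_3,x_4,x_5)+\eta(x_1,x_2,[x_3,x_4,x_5])+\eta(x_4,x_3,x_2)-\eta(x_1,[x_4,x_3,x_2],x_5)$. The degeneracy condition is $\eta(x,x,y)=0=\eta(x,y,y)$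 for all $x,y\in X$. $Z^2_{\rm H}(X,A)$ is the group of $\eta$ with $\delta^2_{(1)}\eta=0=\delta^2_{(2)}\eta$ satisfying the degeneracy condition, and $H^2_{\rm H}(X,A)=Z^2_{\rm H}(X,A)/\mathrm{im}(\delta^1_{\rm PA})$. TSD cohomology with heap coefficients: for $\xi:X\to A$, $\delta^1_{\rm SD}\xi(x_1,x_2,x_3)=\xi(x_1)-\xi(x_2)+\xi(x_3)-\xi(T(x_1,x_2,x_3))$; for $\eta:X^3\to A$, $\delta^2_{\rm SD}\eta(x_1,\dots,x_5)=\eta(x_1,x_2,x_3)+\eta(T(x_1,x_2,x_3),x_4,x_5)-\eta(x_1,x_4,x_5)+\eta(x_2,x_4,x_5)-\eta(x_3,x_4,x_5)-\eta(T(x_1,x_4,x_5),T(x_2,x_4,x_5),T(x_3,x_4,x_5))$. $Z^2_{\rm SD}(X,A)=\ker\delta^2_{\rm SD}$ and $H^2_{\rm SD}(X,A)=Z^2_{\rm SD}(X,A)/\mathrm{im}(\delta^1_{\rm SD})$. *)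

theory Defs
  imports "HOL-Algebra.Product_Groups"
begin

locale ternary_sd =
  fixes X :: "'a set" and T :: "'a \<Rightarrow> 'a \<Rightarrow> 'a \<Rightarrow> 'a"
  assumes op_closed: "\<lbrakk>x \<in> X; y \<in> X; z \<in> X\<rbrakk> \<Longrightarrow> T x y z \<in> X"
    and self_distrib:
      "\<lbrakk>x \<in> X; y \<in> X; z \<in> X; u \<in> X; v \<in> X\<rbrakk> \<Longrightarrow>
        T (T x y z) u v = T (T x u v) (T y u v) (T z u v)"

locale heap =
  fixes X :: "'a set" and br :: "'a \<Rightarrow> 'a \<Rightarrow> 'a \<Rightarrow> 'a"
  assumes nonempty: "X \<noteq> {}"
    and br_closed: "\<lbrakk>x \<in> X; y \<in> X; z \<in> X\<rbrakk> \<Longrightarrow> br x y z \<in> X"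
    and para_assoc1:
      "\<lbrakk>x1 \<in> X; x2 \<in> X; x3 \<in> X; x4 \<in> X; x5 \<in> X\<rbrakk> \<Longrightarrow>
        br (br x1 x2 x3) x4 x5 = br x1 (br x4 x3 x2) x5"
    and para_assoc2:
      "\<lbrakk>x1 \<in> X; x2 \<in> X; x3 \<in> X; x4 \<in> X; x5 \<in> X\<rbrakk> \<Longrightarrow>
        br x1 (br x4 x3 x2) x5 = br x1 x2 (br x3 x4 x5)"
    and br_left: "\<lbrakk>x \<in> X; y \<in> X\<rbrakk> \<Longrightarrow> br x x y = y"
    and br_right: "\<lbrakk>x \<in> X; y \<in> X\<rbrakk> \<Longrightarrow> br x y y = x"

sublocale heap \<subseteq> ternary_sd X br
proof
  fix x y z u v assume X: "x \<in> X" "y \<in> X" "z \<in> X" "u \<in> X" "v \<in> X"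
  have "br (br x u v) (br y u v) (br z u v) = br x (br (br y u v) v u) (br z u v)"
    using X by (simp add: para_assoc1 br_closed)
  also have "br (br y u v) v u = y"
    using X by (simp add: para_assoc1 para_assoc2 br_closed br_left br_right)
  also have "br x y (br z u v) = br (br x y z) u v"
    using X by (simp add: para_assoc1 para_assoc2)
  finally show "br (br x y z) u v = br (br x u v) (br y u v) (br z u v)" ..
qed (rule br_closed)

text \<open>The coefficient group \<open>A\<close> is written multiplicatively, as an abelian group of
  \<open>HOL-Algebra\<close>. The cochain groups are the groups \<open>product_group I (\<lambda>_. A)\<close> of all
  (extensional) functions from \<open>I = X\<close>, \<open>X\<^sup>3\<close> or \<open>X\<^sup>5\<close> to the carrier of \<open>A\<close>.\<close>

abbreviation pow3 :: "'a set \<Rightarrow> ('a \<times> 'a \<times> 'a) set"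
  where "pow3 X \<equiv> X \<times> X \<times> X"

abbreviation pow5 :: "'a set \<Rightarrow> ('a \<times> 'a \<times> 'a \<times> 'a \<times> 'a) set"
  where "pow5 X \<equiv> X \<times> X \<times> X \<times> X \<times> X"

abbreviation cochains :: "'i set \<Rightarrow> ('c, 'm) monoid_scheme \<Rightarrow> ('i \<Rightarrow> 'c) monoid"
  where "cochains I A \<equiv> product_group I (\<lambda>_. A)"

context
  fixes X :: "'a set" and T :: "'a \<Rightarrow> 'a \<Rightarrow> 'a \<Rightarrow> 'a" and A :: "('c, 'm) monoid_scheme" (structure)
begin

subsection \<open>Heap cohomology\<close>

definition delta1_PA :: "('a \<Rightarrow> 'c) \<Rightarrow> 'a \<times> 'a \<times> 'a \<Rightarrow> 'c"
  where "delta1_PA f = (\<lambda>(x, y, z) \<in> pow3 X. f (T x y z) \<otimes> inv (f x) \<otimes> f y \<otimes> inv (f z))"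

definition delta2_1 :: "('a \<times> 'a \<times> 'a \<Rightarrow> 'c) \<Rightarrow> 'a \<times> 'a \<times> 'a \<times> 'a \<times> 'a \<Rightarrow> 'c"
  where "delta2_1 \<eta> = (\<lambda>(x1, x2, x3, x4, x5) \<in> pow5 X.
    \<eta> (x1, x2, x3) \<otimes> \<eta> (T x1 x2 x3, x4, x5) \<otimes> \<eta> (x4, x3, x2)
      \<otimes> inv (\<eta> (x1, T x4 x3 x2, x5)))"

definition delta2_2 :: "('a \<times> 'a \<times> 'a \<Rightarrow> 'c) \<Rightarrow> 'a \<times> 'a \<times> 'a \<times> 'a \<times> 'a \<Rightarrow> 'c"
  where "delta2_2 \<eta> = (\<lambda>(x1, x2, x3, x4, x5) \<in> pow5 X.
    \<eta> (x3, x4, x5) \<otimes> \<eta> (x1, x2, T x3 x4 x5) \<otimes> \<eta> (x4, x3, x2)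
      \<otimes> inv (\<eta> (x1, T x4 x3 x2, x5)))"

definition degenerate :: "('a \<times> 'a \<times> 'a \<Rightarrow> 'c) \<Rightarrow> bool"
  where "degenerate \<eta> \<longleftrightarrow> (\<forall>x\<in>X. \<forall>y\<in>X. \<eta> (x, x, y) = \<one> \<and> \<eta> (x, y, y) = \<one>)"

definition Z2_H :: "('a \<times> 'a \<times> 'a \<Rightarrow> 'c) monoid"
  where "Z2_H = (cochains (pow3 X) A)
    \<lparr>carrier := kernel (cochains (pow3 X) A) (cochains (pow5 X) A) delta2_1
              \<inter> kernel (cochains (pow3 X) A) (cochains (pow5 X) A) delta2_2
              \<inter> {\<eta>. degenerate \<eta>}\<rparr>"

definition B2_H :: "('a \<times> 'a \<times> 'a \<Rightarrow> 'c) set"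
  where "B2_H = delta1_PA ` carrier (cochains X A)"

definition H2_H :: "('a \<times> 'a \<times> 'a \<Rightarrow> 'c) set monoid"
  where "H2_H = Z2_H Mod B2_H"

subsection \<open>Ternary self-distributive cohomology with heap coefficients\<close>

definition delta1_SD :: "('a \<Rightarrow> 'c) \<Rightarrow> 'a \<times> 'a \<times> 'a \<Rightarrow> 'c"
  where "delta1_SD \<xi> = (\<lambda>(x1, x2, x3) \<in> pow3 X.
    \<xi> x1 \<otimes> inv (\<xi> x2) \<otimes> \<xi> x3 \<otimes> inv (\<xi> (T x1 x2 x3)))"

definition delta2_SD :: "('a \<times> 'a \<times> 'a \<Rightarrow> 'c) \<Rightarrow> 'a \<times> 'a \<times> 'a \<times> 'a \<times> 'a \<Rightarrow> 'c"
  where "delta2_SD \<eta> = (\<lambda>(x1, x2, x3, x4, x5) \<in> pow5 X.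
    \<eta> (x1, x2, x3) \<otimes> \<eta> (T x1 x2 x3, x4, x5)
      \<otimes> inv (\<eta> (x1, x4, x5)) \<otimes> \<eta> (x2, x4, x5) \<otimes> inv (\<eta> (x3, x4, x5))
      \<otimes> inv (\<eta> (T x1 x4 x5, T x2 x4 x5, T x3 x4 x5)))"

definition Z2_SD :: "('a \<times> 'a \<times> 'a \<Rightarrow> 'c) monoid"
  where "Z2_SD = (cochains (pow3 X) A)
    \<lparr>carrier := kernel (cochains (pow3 X) A) (cochains (pow5 X) A) delta2_SD\<rparr>"

definition B2_SD :: "('a \<times> 'a \<times> 'a \<Rightarrow> 'c) set"
  where "B2_SD = delta1_SD ` carrier (cochains X A)"

definition H2_SD :: "('a \<times> 'a \<times> 'a \<Rightarrow> 'c) set monoid"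
  where "H2_SD = Z2_SD Mod B2_SD"

end

end

theory Submission
  imports Defs
begin

text \<open>
  The first claim rests on three consequences of the heap cocycle conditions, written additively.
  Subtracting \<open>\<delta>\<^sup>2\<^sub>(\<^sub>2\<^sub>)\<eta> = 0\<close> from \<open>\<delta>\<^sup>2\<^sub>(\<^sub>1\<^sub>)\<eta> = 0\<close> gives the associativity relation
  \<open>\<eta>(x,y,z) + \<eta>([x,y,z],u,v) = \<eta>(z,u,v) + \<eta>(x,y,[z,u,v])\<close>. Since \<open>[[y,u,v],v,u] = y\<close>, the
  condition \<open>\<delta>\<^sup>2\<^sub>(\<^sub>1\<^sub>)\<eta> = 0\<close> at \<open>(x,u,v,[y,u,v],[z,u,v])\<close> rewrites the last term as
  \<open>\<eta>(x,u,v) + \<eta>([x,u,v],[y,u,v],[z,u,v]) + \<eta>([y,u,v],v,u)\<close>. Finally \<open>\<delta>\<^sup>2\<^sub>(\<^sub>1\<^sub>)\<eta> = 0\<close> at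
  \<open>(y,u,v,v,u)\<close> together with degeneracy gives \<open>\<eta>([y,u,v],v,u) = -\<eta>(y,u,v)\<close>, and these
  relations combine to \<open>\<delta>\<^sup>2\<^sub>S\<^sub>D\<eta> = 0\<close> (lemma \<open>delta2_SD_eq_one\<close>).

  For the second claim, \<open>\<delta>\<^sup>1\<^sub>S\<^sub>D\<xi> = \<delta>\<^sup>1\<^sub>P\<^sub>A(-\<xi>)\<close>, so both theories have the same coboundaries
  (lemma \<open>B2_SD_eq_B2_H\<close>). The group of heap cocycles is thus a subgroup of the group of TSD
  cocycles, and both are divided by the same subgroup. A class of heap cocycles is then literally
  the same set as the TSD class of any of its members, and the induced map is the inclusion of one
  set of cosets into the other.
\<close>

text \<open>The translations \<open>y \<mapsto> [y,u,v]\<close> and \<open>y \<mapsto> [y,v,u]\<close> are mutually inverse.\<close>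

lemma (in heap) br_translate_back:
  assumes "y \<in> X" "u \<in> X" "v \<in> X"
  shows "br (br y u v) v u = y"
  using assms by (simp add: para_assoc1 para_assoc2 br_closed br_left br_right)

lemma delta2_1_eq_one_D:
  assumes "heap X T" "comm_group A"
    and \<eta>: "\<eta> \<in> kernel (cochains (pow3 X) A) (cochains (pow5 X) A) (delta2_1 X T A)"
    and X: "x1 \<in> X" "x2 \<in> X" "x3 \<in> X" "x4 \<in> X" "x5 \<in> X"
  shows "\<eta> (x1, x2, x3) \<otimes>\<^bsub>A\<^esub> \<eta> (T x1 x2 x3, x4, x5) \<otimes>\<^bsub>A\<^esub> \<eta> (x4, x3, x2)
    = \<eta> (x1, T x4 x3 x2, x5)"
proof -
  interpret heap X T by fact
  interpret comm_group A by fact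
  have mem: "\<eta> (a, b, c) \<in> carrier A" if "a \<in> X" "b \<in> X" "c \<in> X" for a b c
    using \<eta> that by (auto simp: kernel_def)
  have "delta2_1 X T A \<eta> (x1, x2, x3, x4, x5) = \<one>\<^bsub>A\<^esub>"
    using \<eta> X by (simp add: kernel_def)
  then show ?thesis
    using X by (simp add: delta2_1_def mem br_closed inv_solve_right')
qed

lemma delta2_2_eq_one_D:
  assumes "heap X T" "comm_group A"
    and \<eta>: "\<eta> \<in> kernel (cochains (pow3 X) A) (cochains (pow5 X) A) (delta2_2 X T A)"
    and X: "x1 \<in> X" "x2 \<in> X" "x3 \<in> X" "x4 \<in> X" "x5 \<in> X"
  shows "\<eta> (x3, x4, x5) \<otimes>\<^bsub>A\<^esub> \<eta> (x1, x2, T x3 x4 x5) \<otimes>\<^bsub>A\<^esub> \<eta> (x4, x3, x2)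
    = \<eta> (x1, T x4 x3 x2, x5)"
proof -
  interpret heap X T by fact
  interpret comm_group A by fact
  have mem: "\<eta> (a, b, c) \<in> carrier A" if "a \<in> X" "b \<in> X" "c \<in> X" for a b c
    using \<eta> that by (auto simp: kernel_def)
  have "delta2_2 X T A \<eta> (x1, x2, x3, x4, x5) = \<one>\<^bsub>A\<^esub>"
    using \<eta> X by (simp add: kernel_def)
  then show ?thesis
    using X by (simp add: delta2_2_def mem br_closed inv_solve_right')
qed

text \<open>The purely group-theoretic last step for a heap cocycle: \<open>d = \<eta>(x,y,[z,u,v])\<close> and
  \<open>g = \<eta>([y,u,v],v,u)\<close> are the two values that do not occur in \<open>\<delta>\<^sup>2\<^sub>S\<^sub>D\<eta>(x,y,z,u,v)\<close>, and they
  are eliminated from the three relations.\<close>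

lemma (in comm_group) eliminate_cocycle_terms:
  assumes mem: "a \<in> carrier G" "b \<in> carrier G" "c \<in> carrier G" "d \<in> carrier G"
      "e \<in> carrier G" "f \<in> carrier G" "g \<in> carrier G" "h \<in> carrier G"
    and assoc: "a \<otimes> b = c \<otimes> d" and trans: "e \<otimes> f \<otimes> g = d" and cancel: "h \<otimes> g = \<one>"
  shows "a \<otimes> b \<otimes> inv e \<otimes> h \<otimes> inv c \<otimes> inv f = \<one>"
proof -
  have "a \<otimes> b \<otimes> h = c \<otimes> (e \<otimes> f) \<otimes> (h \<otimes> g)"
    using mem by (simp add: assoc trans[symmetric] m_ac)
  then have "a \<otimes> b \<otimes> h = e \<otimes> c \<otimes> f"
    using mem by (simp add: cancel m_ac)
  moreover have "a \<otimes> b \<otimes> inv e \<otimes> h \<otimes> inv c \<otimes> inv f = a \<otimes> b \<otimes> h \<otimes> inv (e \<otimes> c \<otimes> f)"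
    using mem by (simp add: inv_mult m_ac)
  ultimately show ?thesis
    using mem by simp
qed

lemma delta2_SD_eq_one:
  assumes "heap X T" "comm_group A" and \<eta>: "\<eta> \<in> carrier (Z2_H X T A)"
    and X: "x \<in> X" "y \<in> X" "z \<in> X" "u \<in> X" "v \<in> X"
  shows "delta2_SD X T A \<eta> (x, y, z, u, v) = \<one>\<^bsub>A\<^esub>"
proof -
  interpret heap X T by fact
  interpret comm_group A by fact
  have ker1: "\<eta> \<in> kernel (cochains (pow3 X) A) (cochains (pow5 X) A) (delta2_1 X T A)"
    and ker2: "\<eta> \<in> kernel (cochains (pow3 X) A) (cochains (pow5 X) A) (delta2_2 X T A)"
    and "degenerate X A \<eta>"
    using \<eta> by (auto simp: Z2_H_def)
  then have degen: "\<eta> (a, a, b) = \<one>\<^bsub>A\<^esub>" "\<eta> (a, b, b) = \<one>\<^bsub>A\<^esub>" if "a \<in> X" "b \<in> X" for a b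
    using that by (auto simp: degenerate_def)
  have mem: "\<eta> (a, b, c) \<in> carrier A" if "a \<in> X" "b \<in> X" "c \<in> X" for a b c
    using ker1 that by (auto simp: kernel_def)
  note d1 = delta2_1_eq_one_D[OF assms(1,2) ker1] and d2 = delta2_2_eq_one_D[OF assms(1,2) ker2]
  \<comment> \<open>\<open>\<delta>\<^sup>2\<^sub>(\<^sub>1\<^sub>)\<close> and \<open>\<delta>\<^sup>2\<^sub>(\<^sub>2\<^sub>)\<close> share their last two terms; the common summand \<open>\<eta>(u,z,y)\<close> cancels.\<close>
  have assoc: "\<eta> (x, y, z) \<otimes>\<^bsub>A\<^esub> \<eta> (T x y z, u, v) = \<eta> (z, u, v) \<otimes>\<^bsub>A\<^esub> \<eta> (x, y, T z u v)"
  proof (rule right_cancel[THEN iffD1])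
    show "\<eta> (x, y, z) \<otimes>\<^bsub>A\<^esub> \<eta> (T x y z, u, v) \<otimes>\<^bsub>A\<^esub> \<eta> (u, z, y)
        = \<eta> (z, u, v) \<otimes>\<^bsub>A\<^esub> \<eta> (x, y, T z u v) \<otimes>\<^bsub>A\<^esub> \<eta> (u, z, y)"
      using X by (simp only: d1 d2)
  qed (use X in \<open>simp_all add: mem br_closed\<close>)
  have trans: "\<eta> (x, u, v) \<otimes>\<^bsub>A\<^esub> \<eta> (T x u v, T y u v, T z u v) \<otimes>\<^bsub>A\<^esub> \<eta> (T y u v, v, u)
      = \<eta> (x, y, T z u v)"
    using d1[of x u v "T y u v" "T z u v"] X by (simp add: br_closed br_translate_back)
  have cancel: "\<eta> (y, u, v) \<otimes>\<^bsub>A\<^esub> \<eta> (T y u v, v, u) = \<one>\<^bsub>A\<^esub>"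
    using d1[of y u v v u] X by (simp add: br_closed br_left degen mem)
  show ?thesis
    using X eliminate_cocycle_terms[OF _ _ _ _ _ _ _ _ assoc trans cancel]
    by (simp add: delta2_SD_def mem br_closed)
qed

lemma carrier_Z2_H_subset_Z2_SD:
  assumes "heap X T" "comm_group A"
  shows "carrier (Z2_H X T A) \<subseteq> carrier (Z2_SD X T A)"
proof
  fix \<eta> assume \<eta>: "\<eta> \<in> carrier (Z2_H X T A)"
  have "delta2_SD X T A \<eta> = \<one>\<^bsub>cochains (pow5 X) A\<^esub>"
  proof
    fix p
    show "delta2_SD X T A \<eta> p = \<one>\<^bsub>cochains (pow5 X) A\<^esub> p"
    proof (cases "p \<in> pow5 X")
      case True
      then show ?thesis
        using delta2_SD_eq_one[OF assms \<eta>] by auto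
    next
      \<comment> \<open>Outside \<open>X\<^sup>5\<close> both extensional functions are \<open>undefined\<close>.\<close>
      case False
      then show ?thesis
        by (simp add: delta2_SD_def)
    qed
  qed
  then show "\<eta> \<in> carrier (Z2_SD X T A)"
    using \<eta> by (simp add: Z2_H_def Z2_SD_def kernel_def)
qed

lemma delta1_inverse:
  assumes "heap X T" "comm_group A" and f: "f \<in> carrier (cochains X A)"
  shows "delta1_SD X T A (\<lambda>x\<in>X. inv\<^bsub>A\<^esub> (f x)) = delta1_PA X T A f"
    and "delta1_PA X T A (\<lambda>x\<in>X. inv\<^bsub>A\<^esub> (f x)) = delta1_SD X T A f"
proof -
  interpret heap X T by fact
  interpret comm_group A by fact
  have mem: "f x \<in> carrier A" if "x \<in> X" for x
    using f that by auto
  show "delta1_SD X T A (\<lambda>x\<in>X. inv\<^bsub>A\<^esub> (f x)) = delta1_PA X T A f"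
    and "delta1_PA X T A (\<lambda>x\<in>X. inv\<^bsub>A\<^esub> (f x)) = delta1_SD X T A f"
    unfolding delta1_SD_def delta1_PA_def
    by (intro restrict_ext; clarsimp simp: br_closed mem m_ac)+
qed

text \<open>The two coboundary maps differ by negation of functions \<open>X \<rightarrow> A\<close>, a bijection, so they have
  the same image.\<close>

lemma B2_SD_eq_B2_H:
  assumes "heap X T" "comm_group A"
  shows "B2_SD X T A = B2_H X T A"
proof -
  interpret comm_group A by fact
  have inv_mem: "(\<lambda>x\<in>X. inv\<^bsub>A\<^esub> (f x)) \<in> carrier (cochains X A)"
    if "f \<in> carrier (cochains X A)" for f
    using that by auto
  show ?thesis
  proof
    show "B2_SD X T A \<subseteq> B2_H X T A"
      unfolding B2_SD_def B2_H_def
      using delta1_inverse(2)[OF assms, symmetric] inv_mem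
      by (intro image_subsetI) (rule image_eqI)
    show "B2_H X T A \<subseteq> B2_SD X T A"
      unfolding B2_SD_def B2_H_def
      using delta1_inverse(1)[OF assms, symmetric] inv_mem
      by (intro image_subsetI) (rule image_eqI)
  qed
qed

theorem theorem6p2:
  fixes X :: "'a set" and br :: "'a \<Rightarrow> 'a \<Rightarrow> 'a \<Rightarrow> 'a" and A :: "('c, 'm) monoid_scheme"
  assumes "heap X br" and "comm_group A"
  shows "(\<forall>\<eta> \<in> carrier (Z2_H X br A). \<eta> \<in> carrier (Z2_SD X br A)) \<and>
    (\<exists>\<Phi> \<in> hom (H2_H X br A) (H2_SD X br A).
       (\<forall>\<eta> \<in> carrier (Z2_H X br A).
          \<Phi> (B2_H X br A #>\<^bsub>Z2_H X br A\<^esub> \<eta>) = B2_SD X br A #>\<^bsub>Z2_SD X br A\<^esub> \<eta>) \<and>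
       inj_on \<Phi> (carrier (H2_H X br A)))"
proof -
  let ?ZH = "Z2_H X br A" and ?ZS = "Z2_SD X br A" and ?B = "B2_H X br A"
  note Z = carrier_Z2_H_subset_Z2_SD[OF assms] and B = B2_SD_eq_B2_H[OF assms]
  \<comment> \<open>Cosets and their products refer only to the multiplication, which both cocycle groups inherit
    from the cochain group.\<close>
  have coset: "?B #>\<^bsub>?ZH\<^esub> \<eta> = ?B #>\<^bsub>?ZS\<^esub> \<eta>" for \<eta>
    by (simp add: r_coset_def Z2_H_def Z2_SD_def)
  have setmult: "K <#>\<^bsub>?ZH\<^esub> L = K <#>\<^bsub>?ZS\<^esub> L" for K L
    by (simp add: set_mult_def Z2_H_def Z2_SD_def)
  have "carrier (H2_H X br A) \<subseteq> carrier (H2_SD X br A)"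
    using Z by (auto simp: H2_H_def H2_SD_def FactGroup_def RCOSETS_def B coset)
  then have "id \<in> hom (H2_H X br A) (H2_SD X br A)"
    by (auto simp: hom_def H2_H_def H2_SD_def setmult)
  then show ?thesis
    using Z by (intro conjI bexI[of _ id]) (auto simp: B coset)
qed

end
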